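(* With the matrices defined in the context, let $S_N=\mathbf{B}\mathbf{A_N}^{-1}\mathbf{B}^T$ and $S_D=\mathbf{B}\mathbf{A_D}^{-1}\mathbf{B}^T$. Define $K_1,K_2\in\mathbb{R}^{r\times r}$ by $$K_1=\mathbf{U}\Big(\tfrac{h^2}{2}I_{2n(n-1)}+(\mathbf{B}^T\mathbf{B})^\dagger+(\mathbf{C}^T\mathbf{C})^\dagger\Big)\mathbf{U}^T,\qquad K_2=\mathbf{U}\Big(\tfrac{h^2}{2}I_{2n(n-1)}+(\mathbf{C}^T\mathbf{C})^\dagger\Big)\mathbf{U}^T .$$ Then $K_1,K_2$ are invertible and $$S_D=S_N-(\mathbf{U}\mathbf{B}^\dagger)^T K_1^{-1}(\mathbf{U}\mathbf{B}^\dagger),\qquad S_D^\dagger=S_N^\dagger+(\mathbf{U}\mathbf{B}^\dagger)^T K_2^{-1}(\mathbf{U}\mathbf{B}^\dagger).$$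
   Context: Fix an integer $n\ge 2$ and set $h=1/n$. Let $I_m$ denote the $m\times m$ identity matrix and $\otimes$ the Kronecker product. Let $\mathrm{B}\in\mathbb{R}^{n\times(n-1)}$ be $\mathrm{B}=\frac1h M$, where $M_{i,i}=1$ and $M_{i+1,i}=-1$ for $1\le i\le n-1$, all other entries $0$. Define $\mathrm{B}^u_x=I_n\otimes \mathrm{B}$, $\mathrm{B}^v_y=\mathrm{B}\otimes I_n$, $\mathrm{B}^q_x=I_{n-1}\otimes\mathrm{B}$, $\mathrm{B}^q_y=\mathrm{B}\otimes I_{n-1}$. Let $\mathbf{B}=\begin{bmatrix}-\mathrm{B}^u_x & -\mathrm{B}^v_y\end{bmatrix}\in\mathbb{R}^{n^2\times 2n(n-1)}$ and $\mathbf{C}=\begin{bmatrix}-(\mathrm{B}^q_y)^T & (\mathrm{B}^q_x)^T\end{bmatrix}\in\mathbb{R}^{(n-1)^2\times 2n(n-1)}$, and let $\mathbf{A_N}=\mathbf{B}^T\mathbf{B}+\mathbf{C}^T\mathbf{C}$ (invertible; the Neumann velocity Laplacian). Let $D=\operatorname{diag}(1,0,\dots,0,1)\in\mathbb{R}^{n\times n}$ and let $\mathbf{I}_\sim=\begin{bmatrix}D\otimes I_{n-1} & 0\\ 0 & I_{n-1}\otimes D\end{bmatrix}\in\mathbb{R}^{2n(n-1)\times 2n(n-1)}$, a diagonal $0/1$ matrix of rank $r=4(n-1)$. Let $\mathbf{U}\in\mathbb{R}^{r\times 2n(n-1)}$ be the selection matrix whose rows are the standard basis row vectors $e_j^T$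 for the indices $j$ with $(\mathbf{I}_\sim)_{jj}=1$, so that $\mathbf{U}^T\mathbf{U}=\mathbf{I}_\sim$ and $\mathbf{U}\mathbf{U}^T=I_r$. The Dirichlet velocity Laplacian is $\mathbf{A_D}=\mathbf{A_N}+\frac{2}{h^2}\mathbf{I}_\sim$. The superscript $\dagger$ denotes the Moore–Penrose pseudoinverse. *)

theory Defs
  imports "Jordan_Normal_Form.Matrix"
begin

definition kron :: "real mat \<Rightarrow> real mat \<Rightarrow> real mat" where
  "kron A B = mat (dim_row A * dim_row B) (dim_col A * dim_col B)
     (\<lambda>(i,j). A $$ (i div dim_row B, j div dim_col B) * B $$ (i mod dim_row B, j mod dim_col B))"

definition hcat :: "real mat \<Rightarrow> real mat \<Rightarrow> real mat" where
  "hcat A B = mat (dim_row A) (dim_col A + dim_col B)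
     (\<lambda>(i,j). if j < dim_col A then A $$ (i,j) else B $$ (i, j - dim_col A))"

definition pinv :: "real mat \<Rightarrow> real mat" where
  "pinv A = (THE X. X \<in> carrier_mat (dim_col A) (dim_row A) \<and>
      A * X * A = A \<and> X * A * X = X \<and>
      transpose_mat (A * X) = A * X \<and> transpose_mat (X * A) = X * A)"

definition minv :: "real mat \<Rightarrow> real mat" where
  "minv A = (THE B. B \<in> carrier_mat (dim_row A) (dim_row A) \<and> inverts_mat A B \<and> inverts_mat B A)"

text \<open>B = (1/h) M with h = 1/n, an n x (n-1) matrix.\<close>
definition Bm :: "nat \<Rightarrow> real mat" where
  "Bm n = mat n (n - 1) (\<lambda>(i,j). real n * (if i = j then 1 else if i = j + 1 then -1 else 0))"

definition Bux :: "nat \<Rightarrow> real mat" where "Bux n = kron (1\<^sub>m n) (Bm n)"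
definition Bvy :: "nat \<Rightarrow> real mat" where "Bvy n = kron (Bm n) (1\<^sub>m n)"
definition Bqx :: "nat \<Rightarrow> real mat" where "Bqx n = kron (1\<^sub>m (n - 1)) (Bm n)"
definition Bqy :: "nat \<Rightarrow> real mat" where "Bqy n = kron (Bm n) (1\<^sub>m (n - 1))"

definition BB :: "nat \<Rightarrow> real mat" where
  "BB n = hcat (- Bux n) (- Bvy n)"

definition CC :: "nat \<Rightarrow> real mat" where
  "CC n = hcat (- transpose_mat (Bqy n)) (transpose_mat (Bqx n))"

definition AN :: "nat \<Rightarrow> real mat" where
  "AN n = transpose_mat (BB n) * BB n + transpose_mat (CC n) * CC n"

definition Dm :: "nat \<Rightarrow> real mat" where
  "Dm n = mat n n (\<lambda>(i,j). if i = j \<and> (i = 0 \<or> i = n - 1) then 1 else 0)"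

definition Isim :: "nat \<Rightarrow> real mat" where
  "Isim n = four_block_mat (kron (Dm n) (1\<^sub>m (n - 1))) (0\<^sub>m (n * (n - 1)) (n * (n - 1)))
                           (0\<^sub>m (n * (n - 1)) (n * (n - 1))) (kron (1\<^sub>m (n - 1)) (Dm n))"

definition Uidx :: "nat \<Rightarrow> nat list" where
  "Uidx n = sorted_list_of_set {j. j < 2 * n * (n - 1) \<and> Isim n $$ (j,j) = 1}"

definition Um :: "nat \<Rightarrow> real mat" where
  "Um n = mat (length (Uidx n)) (2 * n * (n - 1)) (\<lambda>(k,j). if j = Uidx n ! k then 1 else 0)"

definition AD :: "nat \<Rightarrow> real mat" where
  "AD n = AN n + (2 / (1 / real n)^2) \<cdot>\<^sub>m Isim n"

definition SN :: "nat \<Rightarrow> real mat" where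
  "SN n = BB n * minv (AN n) * transpose_mat (BB n)"

definition SD :: "nat \<Rightarrow> real mat" where
  "SD n = BB n * minv (AD n) * transpose_mat (BB n)"

definition K1 :: "nat \<Rightarrow> real mat" where
  "K1 n = Um n * (((1 / real n)^2 / 2) \<cdot>\<^sub>m 1\<^sub>m (2 * n * (n - 1))
            + pinv (transpose_mat (BB n) * BB n) + pinv (transpose_mat (CC n) * CC n))
          * transpose_mat (Um n)"

definition K2 :: "nat \<Rightarrow> real mat" where
  "K2 n = Um n * (((1 / real n)^2 / 2) \<cdot>\<^sub>m 1\<^sub>m (2 * n * (n - 1))
            + pinv (transpose_mat (CC n) * CC n))
          * transpose_mat (Um n)"

end

theory Submission
  imports Defs "Jordan_Normal_Form.Determinant"
begin

text \<open>Since B C^T = 0, the summands P = B^T B and Q = C^T C of A = A_N annihilate each other and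
  commute with A. Hence the pseudoinverses of P, Q and B are A^-1 P A^-1, A^-1 Q A^-1 and
  A^-1 B^T, and those of P and Q sum to A^-1. So K_1 = c I + U A^-1 U^T with c = h^2/2 is exactly the
  capacitance matrix of the Woodbury formula for A_D = A + (1/c) U^T U, which gives S_D.
  Moreover H = S_N is an orthogonal projection fixing the columns of V^T, where V is U times the
  pseudoinverse of B, and V V^T = K_1 - K_2. Therefore
  (H - V^T K_1^-1 V) (H + V^T K_2^-1 V) = H in either order, which identifies the pseudoinverse
  of S_D. The matrix A_N is invertible because its off-diagonal blocks cancel and
  each diagonal block is the Gram matrix of an injective matrix plus a positive semidefinite one.\<close>

section \<open>Matrix algebra with dimension side conditions\<close>

text \<open>The premises are equations between dimensions rather than \<open>carrier_mat\<close>
  memberships, so the simplifier can discharge them by computing and use the law as a rewrite rule.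
  The laws that follow have the same form.\<close>

lemma mat_mult_assoc_dim:
  "dim_col A = dim_row B \<Longrightarrow> dim_col B = dim_row C \<Longrightarrow> A * B * C = A * (B * C :: real mat)"
  by (rule assoc_mult_mat[of A "dim_row A" "dim_row B" B "dim_row C" C "dim_col C"])
    (rule carrier_matI; simp)+

lemma mat_distrib_dim:
  fixes A B C :: "real mat"
  shows "dim_row A = dim_row B \<Longrightarrow> dim_col A = dim_col B \<Longrightarrow> dim_col B = dim_row C \<Longrightarrow>
      (A + B) * C = A * C + B * C"
    and "dim_row B = dim_row C \<Longrightarrow> dim_col B = dim_col C \<Longrightarrow> dim_col A = dim_row C \<Longrightarrow>
      A * (B + C) = A * B + A * C"
    and "dim_row A = dim_row B \<Longrightarrow> dim_col A = dim_col B \<Longrightarrow> dim_col B = dim_row C \<Longrightarrow>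
      (A - B) * C = A * C - B * C"
    and "dim_row B = dim_row C \<Longrightarrow> dim_col B = dim_col C \<Longrightarrow> dim_col A = dim_row C \<Longrightarrow>
      A * (B - C) = A * B - A * C"
  by ((rule add_mult_distrib_mat[of A "dim_row A" "dim_row C" B C "dim_col C"]
      mult_add_distrib_mat[of A "dim_row A" "dim_row C" B "dim_col C" C]
      minus_mult_distrib_mat[of A "dim_row A" "dim_row C" B C "dim_col C"]
      mult_minus_distrib_mat[of A "dim_row A" "dim_row C" B "dim_col C" C];
      rule carrier_matI; simp)+)

lemma mat_smult_mult_dim:
  fixes A B :: "real mat"
  assumes "dim_col A = dim_row B"
  shows "(c \<cdot>\<^sub>m A) * B = c \<cdot>\<^sub>m (A * B)" and "A * (c \<cdot>\<^sub>m B) = c \<cdot>\<^sub>m (A * B)"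
  by ((rule mult_smult_assoc_mat[of A "dim_row A" "dim_row B" B "dim_col B" c]
    mult_smult_distrib[of A "dim_row A" "dim_row B" B "dim_col B" c];
    rule carrier_matI; simp add: assms)+)

lemma mat_one_mult_dim:
  fixes A :: "real mat"
  shows "dim_row A = n \<Longrightarrow> 1\<^sub>m n * A = A" and "dim_col A = n \<Longrightarrow> A * 1\<^sub>m n = A"
  by ((rule left_mult_one_mat[of A n "dim_col A"] right_mult_one_mat[of A "dim_row A" n];
    rule carrier_matI; simp)+)

lemma mat_zero_mult_dim:
  fixes A :: "real mat"
  shows "dim_row A = n \<Longrightarrow> 0\<^sub>m m n * A = 0\<^sub>m m (dim_col A)"
    and "dim_col A = n \<Longrightarrow> A * 0\<^sub>m n m = 0\<^sub>m (dim_row A) m"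
  by ((rule left_mult_zero_mat[of A n "dim_col A" m] right_mult_zero_mat[of A "dim_row A" n m];
    rule carrier_matI; simp)+)

lemma mat_zero_add_dim:
  fixes A :: "real mat"
  shows "dim_row A = m \<Longrightarrow> dim_col A = n \<Longrightarrow> 0\<^sub>m m n + A = A"
    and "dim_row A = m \<Longrightarrow> dim_col A = n \<Longrightarrow> A + 0\<^sub>m m n = A"
  by ((rule left_add_zero_mat[of A m n] right_add_zero_mat[of A m n];
    rule carrier_matI; simp)+)

lemma mat_transpose_dim:
  fixes A B :: "real mat"
  shows "dim_col A = dim_row B \<Longrightarrow> transpose_mat (A * B) = transpose_mat B * transpose_mat A"
    and "dim_row A = dim_row C \<Longrightarrow> dim_col A = dim_col C \<Longrightarrow>
      transpose_mat (A + C) = transpose_mat A + transpose_mat C"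
    and "dim_row A = dim_row C \<Longrightarrow> dim_col A = dim_col C \<Longrightarrow>
      transpose_mat (A - C) = transpose_mat A - transpose_mat C"
    and "transpose_mat (c \<cdot>\<^sub>m A) = c \<cdot>\<^sub>m transpose_mat A"
     apply (rule transpose_mult[of A "dim_row A" "dim_row B" B "dim_col B"]; rule carrier_matI; simp)
    apply (rule transpose_add[of A "dim_row C" "dim_col C" C]; rule carrier_matI; simp)
   apply (rule transpose_minus[of A "dim_row C" "dim_col C" C]; rule carrier_matI; simp)
  apply (rule eq_matI; simp)
  done

text \<open>Rewriting to a normal form: products associate to the right, sums and differences are
  multiplied out, scalars move to the front and transposes move inwards.\<close>

lemmas mat_ring_simps = mat_mult_assoc_dim mat_distrib_dim mat_smult_mult_dim mat_one_mult_dim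
  mat_zero_mult_dim mat_zero_add_dim mat_transpose_dim

section \<open>Uniqueness of inverses and pseudoinverses\<close>

lemma minv_eqI:
  assumes "A \<in> carrier_mat n n" "R \<in> carrier_mat n n" "A * R = 1\<^sub>m n"
  shows "minv A = R"
  unfolding minv_def
proof (rule the_equality)
  note dims = carrier_matD[OF assms(1)] carrier_matD[OF assms(2)]
  have "R * A = 1\<^sub>m n" by (rule mat_mult_left_right_inverse[OF assms])
  then show "R \<in> carrier_mat (dim_row A) (dim_row A) \<and> inverts_mat A R \<and> inverts_mat R A"
    unfolding inverts_mat_def using assms dims by simp
  fix X assume X: "X \<in> carrier_mat (dim_row A) (dim_row A) \<and> inverts_mat A X \<and> inverts_mat X A"
  then have d: "dim_row X = n" "dim_col X = n" using dims by auto
  with X have "X * A = 1\<^sub>m n" unfolding inverts_mat_def by simp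
  then have "X * A * R = R" using dims by (simp only: mat_one_mult_dim)
  moreover have "X * A * R = X * (A * R)" using dims d by (intro mat_mult_assoc_dim) simp_all
  ultimately show "X = R" using d by (simp only: assms(3) mat_one_mult_dim)
qed

lemma invertible_matI:
  assumes "A \<in> carrier_mat n n" "R \<in> carrier_mat n n" "A * R = 1\<^sub>m n"
  shows "invertible_mat (A :: real mat)"
proof -
  note dims = carrier_matD[OF assms(1)] carrier_matD[OF assms(2)]
  have "R * A = 1\<^sub>m n" by (rule mat_mult_left_right_inverse[OF assms])
  then have "inverts_mat A R \<and> inverts_mat R A" using assms(3) dims by (simp add: inverts_mat_def)
  then show ?thesis using dims by (auto simp: invertible_mat_def)
qed

text \<open>Penrose's uniqueness argument. Two candidates X and Y satisfy A X = A Y and X A = Y A,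
  hence Y = Y A Y = X A Y = X A X = X. This is what gives the definite description in
  \<open>pinv\<close> a value.\<close>

lemma pinv_eqI:
  assumes X: "X \<in> carrier_mat (dim_col A) (dim_row A)" "A * X * A = A" "X * A * X = X"
    "transpose_mat (A * X) = A * X" "transpose_mat (X * A) = X * A"
  shows "pinv A = X"
  unfolding pinv_def
proof (rule the_equality)
  show "X \<in> carrier_mat (dim_col A) (dim_row A) \<and> A * X * A = A \<and> X * A * X = X \<and>
    transpose_mat (A * X) = A * X \<and> transpose_mat (X * A) = X * A"
    using assms by blast
  fix Y assume "Y \<in> carrier_mat (dim_col A) (dim_row A) \<and> A * Y * A = A \<and> Y * A * Y = Y \<and>
    transpose_mat (A * Y) = A * Y \<and> transpose_mat (Y * A) = Y * A"
  then have Y: "Y \<in> carrier_mat (dim_col A) (dim_row A)" "A * Y * A = A" "Y * A * Y = Y"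
    "transpose_mat (A * Y) = A * Y" "transpose_mat (Y * A) = Y * A" by auto
  note d = X(1)[THEN carrier_matD(1)] X(1)[THEN carrier_matD(2)]
    Y(1)[THEN carrier_matD(1)] Y(1)[THEN carrier_matD(2)]
  have AXY: "A * X = A * Y"
  proof -
    \<comment> \<open>Transposing swaps the two symmetric factors A Y and A X, after which A X A
      collapses to A.\<close>
    have "A * X = transpose_mat (A * Y * A * X)" using X Y by simp
    also have "A * Y * A * X = (A * Y) * (A * X)" using d by (simp add: mat_mult_assoc_dim)
    also have "transpose_mat \<dots> = transpose_mat (A * X) * transpose_mat (A * Y)"
      using d by (intro mat_transpose_dim) simp
    also have "\<dots> = A * X * A * Y" unfolding X(4,5) Y(4,5) using d by (simp add: mat_mult_assoc_dim)
    finally show ?thesis using X by simp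
  qed
  have XYA: "X * A = Y * A"
  proof -
    have "X * A = transpose_mat (X * (A * Y * A))" using X Y by simp
    also have "X * (A * Y * A) = (X * A) * (Y * A)" using d by (simp add: mat_mult_assoc_dim)
    also have "transpose_mat \<dots> = transpose_mat (Y * A) * transpose_mat (X * A)"
      using d by (intro mat_transpose_dim) simp
    also have "\<dots> = Y * (A * X * A)" unfolding X(4,5) Y(4,5) using d by (simp add: mat_mult_assoc_dim)
    finally show ?thesis using X by simp
  qed
  have "Y = Y * A * Y" using Y by simp
  also have "\<dots> = X * A * Y" by (simp add: XYA)
  also have "\<dots> = X * (A * Y)" using d by (intro mat_mult_assoc_dim) simp_all
  also have "\<dots> = X * A * X" unfolding AXY[symmetric] using d
    by (intro mat_mult_assoc_dim[symmetric]) simp_all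
  finally show "Y = X" using X by simp
qed

section \<open>Nonnegative quadratic forms and invertibility\<close>

definition psd_mat :: "nat \<Rightarrow> real mat \<Rightarrow> bool" where
  "psd_mat n M \<longleftrightarrow> M \<in> carrier_mat n n \<and> (\<forall>x\<in>carrier_vec n. 0 \<le> x \<bullet> (M *\<^sub>v x))"

lemma scalar_prod_gram:
  fixes G :: "real mat"
  assumes "G \<in> carrier_mat m n" "x \<in> carrier_vec n"
  shows "x \<bullet> ((transpose_mat G * G) *\<^sub>v x) = (G *\<^sub>v x) \<bullet> (G *\<^sub>v x)"
proof -
  have Gx: "G *\<^sub>v x \<in> carrier_vec m" using assms by (rule mult_mat_vec_carrier)
  have G': "transpose_mat G \<in> carrier_mat n m" using assms by simp
  have "(transpose_mat G * G) *\<^sub>v x = transpose_mat G *\<^sub>v (G *\<^sub>v x)"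
    by (rule assoc_mult_mat_vec[OF G' assms])
  moreover have "x \<bullet> (transpose_mat G *\<^sub>v (G *\<^sub>v x)) = (transpose_mat G *\<^sub>v (G *\<^sub>v x)) \<bullet> x"
    by (rule comm_scalar_prod[OF assms(2) mult_mat_vec_carrier[OF G' Gx]])
  moreover have "\<dots> = (G *\<^sub>v x) \<bullet> (G *\<^sub>v x)"
    by (rule transpose_vec_mult_scalar[OF assms Gx])
  ultimately show ?thesis by simp
qed

lemma scalar_prod_self_real:
  fixes v :: "real vec"
  shows "0 \<le> v \<bullet> v" and "v \<bullet> v = 0 \<Longrightarrow> v = 0\<^sub>v (dim_vec v)"
  using conjugate_square_ge_0_vec[of v] conjugate_square_eq_0_vec[of v "dim_vec v"]
  by simp_all

lemma psd_mat_gram: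
  assumes "G \<in> carrier_mat m n"
  shows "psd_mat n (transpose_mat G * G)"
  unfolding psd_mat_def
proof (intro conjI ballI)
  show "transpose_mat G * G \<in> carrier_mat n n"
    using assms by (intro mult_carrier_mat[of _ n m]) simp_all
  show "0 \<le> x \<bullet> (transpose_mat G * G *\<^sub>v x)" if "x \<in> carrier_vec n" for x
    by (subst scalar_prod_gram[OF assms that]) (rule scalar_prod_self_real)
qed

lemma scalar_prod_add_mat:
  fixes M :: "real mat"
  assumes "M \<in> carrier_mat n n" "M' \<in> carrier_mat n n" "x \<in> carrier_vec n"
  shows "x \<bullet> ((M + M') *\<^sub>v x) = x \<bullet> (M *\<^sub>v x) + x \<bullet> (M' *\<^sub>v x)"
  unfolding add_mult_distrib_mat_vec[OF assms]
  by (rule scalar_prod_add_distrib[OF assms(3) mult_mat_vec_carrier[OF assms(1,3)]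
      mult_mat_vec_carrier[OF assms(2,3)]])

lemma psd_mat_add:
  assumes "psd_mat n M" "psd_mat n M'"
  shows "psd_mat n (M + M')"
  unfolding psd_mat_def
proof (intro conjI ballI)
  have c: "M \<in> carrier_mat n n" "M' \<in> carrier_mat n n" using assms by (simp_all add: psd_mat_def)
  then show "M + M' \<in> carrier_mat n n" by simp
  show "0 \<le> x \<bullet> ((M + M') *\<^sub>v x)" if "x \<in> carrier_vec n" for x
    unfolding scalar_prod_add_mat[OF c that]
    using assms that by (intro add_nonneg_nonneg) (simp_all add: psd_mat_def)
qed

text \<open>A kernel vector v of the sum satisfies |G v|^2 + v . M v = 0 with both terms
  nonnegative, so G v = 0, and the left inverse L gives v = 0. Injectivity of G enters as the
  existence of L.\<close>

lemma gram_plus_psd_inverse: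
  assumes G: "G \<in> carrier_mat m n" and L: "L \<in> carrier_mat n m" "L * G = 1\<^sub>m n"
    and M: "psd_mat n M"
  obtains R where "R \<in> carrier_mat n n" "(transpose_mat G * G + M) * R = 1\<^sub>m n"
proof -
  let ?K = "transpose_mat G * G + M"
  have Gc: "transpose_mat G * G \<in> carrier_mat n n"
    using psd_mat_gram[OF G] by (simp add: psd_mat_def)
  have Mc: "M \<in> carrier_mat n n" using M by (simp add: psd_mat_def)
  have K: "?K \<in> carrier_mat n n" using Mc by (rule add_carrier_mat)
  have "det ?K \<noteq> 0"
  proof
    assume "det ?K = 0"
    then obtain v where v: "v \<in> carrier_vec n" "v \<noteq> 0\<^sub>v n" "?K *\<^sub>v v = 0\<^sub>v n"
      using det_0_iff_vec_prod_zero[OF K] by blast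
    have "(G *\<^sub>v v) \<bullet> (G *\<^sub>v v) + v \<bullet> (M *\<^sub>v v) = v \<bullet> 0\<^sub>v n"
      unfolding scalar_prod_gram[OF G v(1), symmetric] scalar_prod_add_mat[OF Gc Mc v(1), symmetric] v(3) ..
    also have "\<dots> = 0" using v(1) by simp
    finally have "(G *\<^sub>v v) \<bullet> (G *\<^sub>v v) = 0"
      using M v(1) scalar_prod_self_real(1)[of "G *\<^sub>v v"] unfolding psd_mat_def by force
    then have "G *\<^sub>v v = 0\<^sub>v (dim_vec (G *\<^sub>v v))" by (rule scalar_prod_self_real(2))
    then have Gv: "G *\<^sub>v v = 0\<^sub>v m" using G by simp
    have "v = L * G *\<^sub>v v" using v L(2) by simp
    also have "\<dots> = L *\<^sub>v (G *\<^sub>v v)" by (rule assoc_mult_mat_vec[OF L(1) G v(1)])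
    also have "\<dots> = 0\<^sub>v n" unfolding Gv using L(1) by auto
    finally show False using v(2) by simp
  qed
  then have "?K \<in> Units (ring_mat TYPE(real) n ())" by (rule det_non_zero_imp_unit[OF K])
  then obtain R where "R \<in> carrier_mat n n" "?K * R = 1\<^sub>m n"
    unfolding Units_def ring_mat_def by auto
  then show thesis by (rule that)
qed

section \<open>Pseudoinverses of projections and of their low-rank updates\<close>

lemma pinv_projection:
  fixes H :: "real mat"
  assumes "H \<in> carrier_mat m m" "transpose_mat H = H" "H * H = H"
  shows "pinv H = H"
  using assms by (intro pinv_eqI) auto

lemma mat_add_eq_imp_eq_minus:
  fixes X Y Z :: "real mat"
  assumes "X + Y = Z" "dim_row X = dim_row Y" "dim_col X = dim_col Y"
  shows "Y = Z - X"
  using assms by (intro eq_matI) (auto simp flip: assms(1))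

text \<open>The last two premises are resolvent identities: they hold when J and J' invert two
  matrices whose difference is W^T W. They make all terms except H cancel in both products of the
  two updated matrices. Since H is symmetric and fixes both from the left, the Penrose conditions
  follow.\<close>

lemma pinv_projection_update:
  fixes H W J J' :: "real mat"
  assumes H: "H \<in> carrier_mat m m" "transpose_mat H = H" "H * H = H"
    and W: "W \<in> carrier_mat m r" "H * W = W"
    and J: "J \<in> carrier_mat r r" "J' \<in> carrier_mat r r"
    and JJ': "J * (transpose_mat W * (W * J')) = J' - J"
    and J'J: "J' * (transpose_mat W * (W * J)) = J' - J"
  shows "pinv (H - W * (J * transpose_mat W)) = H + W * (J' * transpose_mat W)"
proof -
  note dims [simp] = carrier_matD[OF H(1)] carrier_matD[OF W(1)] carrier_matD[OF J(1)]
    carrier_matD[OF J(2)]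
  let ?V = "transpose_mat W"
  let ?S = "H - W * (J * ?V)" and ?X = "H + W * (J' * ?V)"
  \<comment> \<open>In right-associated products H W occurs only with a further factor behind it, so
    the absorption rule is restated with a trailing Z; \<open>JJV\<close> and \<open>J'JV\<close>
    below likewise carry a trailing W^T.\<close>
  have HW: "H * (W * Z) = W * Z" if "dim_row Z = r" for Z
    using mat_mult_assoc_dim[of H W Z] that W(2) by simp
  have VH: "?V * H = ?V"
    using arg_cong[OF W(2), of transpose_mat] by (simp add: mat_transpose_dim H(2))
  have JJV: "J * (?V * (W * (J' * ?V))) = J' * ?V - J * ?V"
    and J'JV: "J' * (?V * (W * (J * ?V))) = J' * ?V - J * ?V"
    using arg_cong[OF JJ', of "\<lambda>Z. Z * ?V"] arg_cong[OF J'J, of "\<lambda>Z. Z * ?V"]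
    by (simp_all add: mat_ring_simps)
  note simps = mat_ring_simps H(2,3) W(2) HW VH JJV J'JV
  \<comment> \<open>The two shapes that the normalised products take, with P = H, Q = W J' W^T and R
    = W J W^T.\<close>
  have cancel: "P + Q - (R + (Q - R)) = P" "P - R + (Q - (Q - R)) = P"
    if "dim_row P = p" "dim_row Q = p" "dim_row R = p"
      "dim_col P = q" "dim_col Q = q" "dim_col R = q" for P Q R :: "real mat" and p q
    using that by (auto intro!: eq_matI)
  have SX: "?S * ?X = H" and XS: "?X * ?S = H"
    by (simp_all add: simps cancel)
  have SXS: "H * ?S = ?S" and XSX: "H * ?X = ?X"
    by (simp_all add: simps)
  have "?X \<in> carrier_mat (dim_col ?S) (dim_row ?S)" by (rule carrier_matI) simp_all
  then show ?thesis by (rule pinv_eqI) (simp_all only: SX XS SXS XSX H(2))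
qed

section \<open>Schur complements of an orthogonal pair of factors\<close>

text \<open>The algebra is separated from the grid: two factors with mutually orthogonal row spaces,
  and an inverse \<open>Ai\<close> of the sum of their Gram matrices. The grid matrices enter only
  by interpretation in \<open>theorem2\<close>.\<close>

locale orthogonal_factors =
  fixes m k d :: nat and B C Ai :: "real mat"
  assumes B: "B \<in> carrier_mat m d" and C: "C \<in> carrier_mat k d" and Ai: "Ai \<in> carrier_mat d d"
    and BC: "B * transpose_mat C = 0\<^sub>m m k"
    and inverse: "(transpose_mat B * B + transpose_mat C * C) * Ai = 1\<^sub>m d"
begin

lemma dims [simp]: "dim_row B = m" "dim_col B = d" "dim_row C = k" "dim_col C = d"
  "dim_row Ai = d" "dim_col Ai = d"
  using B C Ai by auto

lemma CB: "C * transpose_mat B = 0\<^sub>m k m"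
proof -
  have "transpose_mat (B * transpose_mat C) = C * transpose_mat B" by (simp add: mat_ring_simps)
  then show ?thesis by (simp add: BC)
qed

text \<open>The setting is symmetric in the two factors, so each fact proved for B becomes available
  for C by interpreting the locale a second time.\<close>

lemma swap: "orthogonal_factors k m d C B Ai"
proof
  have "transpose_mat C * C + transpose_mat B * B = transpose_mat B * B + transpose_mat C * C"
    by (intro comm_add_mat) auto
  then show "(transpose_mat C * C + transpose_mat B * B) * Ai = 1\<^sub>m d" by (simp add: inverse)
qed (use B C Ai CB in auto)

abbreviation "A \<equiv> transpose_mat B * B + transpose_mat C * C"

lemma left_inverse: "Ai * A = 1\<^sub>m d"
  by (rule mat_mult_left_right_inverse[OF _ _ inverse]) auto

text \<open>As A is symmetric, the transpose of \<open>Ai\<close> is a left inverse of A, and it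
  must agree with the right inverse.\<close>

lemma Ai_sym: "transpose_mat Ai = Ai"
proof -
  have "transpose_mat Ai * A = transpose_mat (A * Ai)" by (simp add: mat_ring_simps)
  then have "transpose_mat Ai * A * Ai = Ai" by (simp add: inverse mat_ring_simps)
  moreover have "transpose_mat Ai * A * Ai = transpose_mat Ai * (A * Ai)"
    by (rule mat_mult_assoc_dim) auto
  ultimately show ?thesis by (simp add: inverse mat_ring_simps)
qed

text \<open>With P = B^T B and Q = C^T C, orthogonality gives P Q = Q P = 0, so P A = P P = A P.
  Multiplying by A^-1 on both sides yields the claim.\<close>

lemma commute: "Ai * (transpose_mat B * B) = transpose_mat B * (B * Ai)"
proof -
  let ?P = "transpose_mat B * B"
  have z: "B * (transpose_mat C * C) = 0\<^sub>m m d" "C * (transpose_mat B * B) = 0\<^sub>m k d"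
    using mat_mult_assoc_dim[of B "transpose_mat C" C] mat_mult_assoc_dim[of C "transpose_mat B" B]
    by (simp_all only: BC CB mat_zero_mult_dim dims index_transpose_mat)
  have "?P * A = A * ?P" by (simp add: mat_ring_simps z)
  then have "Ai * (?P * A) * Ai = Ai * (A * ?P) * Ai" by simp
  moreover have "Ai * (?P * A) * Ai = Ai * ?P * (A * Ai)"
    by (simp only: mat_mult_assoc_dim dims index_mult_mat index_add_mat index_transpose_mat)
  moreover have "Ai * (A * ?P) * Ai = (Ai * A) * ?P * Ai"
    by (simp only: mat_mult_assoc_dim dims index_mult_mat index_add_mat index_transpose_mat)
  ultimately show ?thesis
    by (simp add: inverse left_inverse mat_one_mult_dim) (simp add: mat_ring_simps)
qed

text \<open>The form of \<open>commute\<close> that still matches inside a longer right-associated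
  product; \<open>B_Ai_gram_mult\<close> does the same for \<open>B_Ai_gram\<close>.\<close>

lemma commute_mult:
  assumes "dim_row X = d"
  shows "Ai * (transpose_mat B * (B * X)) = transpose_mat B * (B * (Ai * X))"
proof -
  have "Ai * (transpose_mat B * (B * X)) = Ai * (transpose_mat B * B) * X"
    using assms by (simp add: mat_mult_assoc_dim)
  also have "\<dots> = transpose_mat B * (B * (Ai * X))"
    using assms by (simp only: commute) (simp add: mat_mult_assoc_dim)
  finally show ?thesis .
qed

text \<open>Commutation for the swapped pair gives B A^-1 Q = B Q A^-1 = 0, so only the P part of A
  survives in B = B A^-1 A.\<close>

lemma B_Ai_gram: "B * (Ai * (transpose_mat B * B)) = B"
proof -
  interpret s: orthogonal_factors k m d C B Ai by (rule swap)
  have "B * (Ai * (transpose_mat C * C)) = 0\<^sub>m m d"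
    using mat_mult_assoc_dim[of B "transpose_mat C" "C * Ai"]
    by (simp add: s.commute BC mat_zero_mult_dim)
  moreover have "B * (Ai * A) = B * (Ai * (transpose_mat B * B)) + B * (Ai * (transpose_mat C * C))"
    by (simp add: mat_ring_simps)
  ultimately show ?thesis by (simp add: left_inverse mat_ring_simps)
qed

lemma gram_Ai_B: "transpose_mat B * (B * (Ai * transpose_mat B)) = transpose_mat B"
  using arg_cong[OF B_Ai_gram, of transpose_mat] by (simp add: mat_ring_simps Ai_sym)

lemma B_Ai_gram_mult:
  assumes "dim_row X = d"
  shows "B * (Ai * (transpose_mat B * (B * X))) = B * X"
proof -
  have "B * (Ai * (transpose_mat B * (B * X))) = B * (Ai * (transpose_mat B * B)) * X"
    using assms by (simp add: mat_mult_assoc_dim)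
  then show ?thesis by (simp only: B_Ai_gram)
qed

text \<open>Two Penrose conditions are \<open>B_Ai_gram\<close> and its transpose; the symmetry of
  A^-1 P is \<open>commute\<close>.\<close>

lemma pinv_B: "pinv B = Ai * transpose_mat B"
proof (rule pinv_eqI)
  show "B * (Ai * transpose_mat B) * B = B"
    by (simp add: mat_mult_assoc_dim B_Ai_gram)
  show "Ai * transpose_mat B * B * (Ai * transpose_mat B) = Ai * transpose_mat B"
    by (simp add: mat_mult_assoc_dim gram_Ai_B)
  show "transpose_mat (B * (Ai * transpose_mat B)) = B * (Ai * transpose_mat B)"
    by (simp add: mat_ring_simps Ai_sym)
  show "transpose_mat (Ai * transpose_mat B * B) = Ai * transpose_mat B * B"
    by (simp add: mat_ring_simps Ai_sym commute)
qed auto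

lemma pinv_gram: "pinv (transpose_mat B * B) = Ai * (transpose_mat B * (B * Ai))"
proof (rule pinv_eqI)
  show "transpose_mat B * B * (Ai * (transpose_mat B * (B * Ai))) * (transpose_mat B * B) =
    transpose_mat B * B"
    by (simp add: mat_mult_assoc_dim B_Ai_gram_mult B_Ai_gram)
  show "Ai * (transpose_mat B * (B * Ai)) * (transpose_mat B * B) *
    (Ai * (transpose_mat B * (B * Ai))) = Ai * (transpose_mat B * (B * Ai))"
    by (simp add: mat_mult_assoc_dim B_Ai_gram_mult)
  show "transpose_mat (transpose_mat B * B * (Ai * (transpose_mat B * (B * Ai)))) =
    transpose_mat B * B * (Ai * (transpose_mat B * (B * Ai)))"
    by (simp add: mat_ring_simps Ai_sym commute commute_mult)
  show "transpose_mat (Ai * (transpose_mat B * (B * Ai)) * (transpose_mat B * B)) =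
    Ai * (transpose_mat B * (B * Ai)) * (transpose_mat B * B)"
    by (simp add: mat_ring_simps Ai_sym commute commute_mult)
qed auto

text \<open>The two pseudoinverses are A^-1 P A^-1 and A^-1 Q A^-1, so their sum is A^-1 A
  A^-1.\<close>

lemma sum_pinv_gram:
  "pinv (transpose_mat B * B) + pinv (transpose_mat C * C) = Ai"
proof -
  interpret s: orthogonal_factors k m d C B Ai by (rule swap)
  have "Ai * A * Ai = Ai" by (simp only: left_inverse mat_one_mult_dim dims)
  then show ?thesis by (simp add: pinv_gram s.pinv_gram mat_ring_simps)
qed

text \<open>The theorem for any U with orthonormal rows and any c > 0. The proof has three stages: K
  and K' are c I plus Gram matrices and hence invertible; the Woodbury formula gives S'; the
  projection update gives its pseudoinverse.\<close>

lemma schur_complement_update: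
  fixes U :: "real mat" and c :: real
  assumes U: "U \<in> carrier_mat r d" "U * transpose_mat U = 1\<^sub>m r" and c: "c > 0"
  defines "K \<equiv> U * (c \<cdot>\<^sub>m 1\<^sub>m d + pinv (transpose_mat B * B) + pinv (transpose_mat C * C)) * transpose_mat U"
    and "K' \<equiv> U * (c \<cdot>\<^sub>m 1\<^sub>m d + pinv (transpose_mat C * C)) * transpose_mat U"
    and "S \<equiv> B * minv A * transpose_mat B"
    and "S' \<equiv> B * minv (A + (1 / c) \<cdot>\<^sub>m (transpose_mat U * U)) * transpose_mat B"
    and "V \<equiv> U * pinv B"
  shows "invertible_mat K" "invertible_mat K'"
    "S' = S - transpose_mat V * minv K * V"
    "pinv S' = pinv S + transpose_mat V * minv K' * V"
proof -
  interpret s: orthogonal_factors k m d C B Ai by (rule swap)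
  note dimU [simp] = carrier_matD[OF U(1)]
  have dimp [simp]: "dim_row (pinv (transpose_mat B * B)) = d" "dim_col (pinv (transpose_mat B * B)) = d"
    "dim_row (pinv (transpose_mat C * C)) = d" "dim_col (pinv (transpose_mat C * C)) = d"
    by (simp_all add: pinv_gram s.pinv_gram)
  define P where "P = U * pinv (transpose_mat B * B) * transpose_mat U"
  define Q where "Q = U * pinv (transpose_mat C * C) * transpose_mat U"
  let ?c = "c \<cdot>\<^sub>m 1\<^sub>m r :: real mat"
  have dimPQ [simp]: "dim_row P = r" "dim_col P = r" "dim_row Q = r" "dim_col Q = r"
    by (simp_all add: P_def Q_def)
  have assoc: "X + Y + Z = X + (Y + Z)" "X + (Y + Z) = X + Z + Y"
    if "dim_row X = p" "dim_row Y = p" "dim_row Z = p"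
      "dim_col X = q" "dim_col Y = q" "dim_col Z = q" for X Y Z :: "real mat" and p q
    using that by (auto intro!: eq_matI)
  \<comment> \<open>Since U U^T = I, compressing c I of size d by U gives c I of size r.\<close>
  have K: "K = ?c + (P + Q)" and K': "K' = ?c + Q"
    unfolding K_def K'_def P_def Q_def by (simp_all add: mat_ring_simps U(2) assoc(1)[of _ r _ _ r])
  have PQ: "P + Q = U * (Ai * transpose_mat U)"
    unfolding P_def Q_def by (simp add: mat_ring_simps flip: sum_pinv_gram)
  have P: "P = U * (Ai * (transpose_mat B * (B * (Ai * transpose_mat U))))"
    unfolding P_def by (simp add: pinv_gram mat_ring_simps)
  \<comment> \<open>P and Q are the Gram matrices of B A^-1 U^T and C A^-1 U^T, hence positive
    semidefinite.\<close>
  have "P = transpose_mat (B * (Ai * transpose_mat U)) * (B * (Ai * transpose_mat U))"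
    unfolding P by (simp add: mat_ring_simps Ai_sym)
  then have psdP: "psd_mat r P"
    using psd_mat_gram[of "B * (Ai * transpose_mat U)" m r] by (simp add: carrier_matI)
  have "Q = transpose_mat (C * (Ai * transpose_mat U)) * (C * (Ai * transpose_mat U))"
    unfolding Q_def by (simp add: mat_ring_simps Ai_sym s.pinv_gram)
  then have psdQ: "psd_mat r Q"
    using psd_mat_gram[of "C * (Ai * transpose_mat U)" k r] by (simp add: carrier_matI)
  \<comment> \<open>The factor sqrt c presents c I as the Gram matrix of an injective matrix, as
    \<open>gram_plus_psd_inverse\<close> expects.\<close>
  let ?G = "sqrt c \<cdot>\<^sub>m 1\<^sub>m r :: real mat" and ?L = "(1 / sqrt c) \<cdot>\<^sub>m 1\<^sub>m r :: real mat"
  have "?L * ?G = 1\<^sub>m r" and cc: "transpose_mat ?G * ?G = ?c"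
    using c by (auto simp: mat_ring_simps intro!: eq_matI)
  then have inv: "\<exists>R. R \<in> carrier_mat r r \<and> (?c + M) * R = 1\<^sub>m r" if "psd_mat r M" for M
    using gram_plus_psd_inverse[of ?G r r ?L M] that by (metis cc smult_carrier_mat one_carrier_mat)
  obtain J where J: "J \<in> carrier_mat r r" "K * J = 1\<^sub>m r"
    using inv[OF psd_mat_add[OF psdP psdQ]] unfolding K by blast
  obtain J' where J': "J' \<in> carrier_mat r r" "K' * J' = 1\<^sub>m r"
    using inv[OF psdQ] unfolding K' by blast
  have carK: "K \<in> carrier_mat r r" "K' \<in> carrier_mat r r"
    by (rule carrier_matI; simp add: K K')+
  note dimJ [simp] = carrier_matD[OF J(1)] carrier_matD[OF J'(1)] carrier_matD[OF carK(1)]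
    carrier_matD[OF carK(2)]
  have JK: "J * K = 1\<^sub>m r" "J' * K' = 1\<^sub>m r"
    using mat_mult_left_right_inverse[OF carK(1) J] mat_mult_left_right_inverse[OF carK(2) J'] by auto
  show "invertible_mat K" "invertible_mat K'"
    using invertible_matI[OF carK(1) J] invertible_matI[OF carK(2) J'] by auto
  have minvK: "minv K = J" "minv K' = J'"
    using minv_eqI[OF carK(1) J] minv_eqI[OF carK(2) J'] by auto
  have minvA: "minv A = Ai"
    by (rule minv_eqI[OF _ Ai inverse]) (rule carrier_matI; simp)

  have V: "V = U * (Ai * transpose_mat B)" and VT: "transpose_mat V = B * (Ai * transpose_mat U)"
    unfolding V_def pinv_B by (simp_all add: mat_ring_simps Ai_sym)
  \<comment> \<open>The Woodbury inverse of A + (1/c) U^T U. Its verification rests on U A^-1 U^T J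
    = I - c J, which is K J = I rearranged.\<close>
  let ?D = "Ai - Ai * (transpose_mat U * (J * (U * Ai)))"
  have "?c * J + (P + Q) * J = 1\<^sub>m r"
    using J(2) unfolding K by (simp add: mat_distrib_dim)
  then have "(P + Q) * J = 1\<^sub>m r - ?c * J"
    by (rule mat_add_eq_imp_eq_minus) simp_all
  then have "(P + Q) * J * (U * Ai) = (1\<^sub>m r - ?c * J) * (U * Ai)" by simp
  then have UJ: "U * (Ai * (transpose_mat U * (J * (U * Ai)))) = U * Ai - c \<cdot>\<^sub>m (J * (U * Ai))"
    unfolding PQ by (simp add: mat_ring_simps)
  \<comment> \<open>An opaque name keeps the distributive laws from splitting A into its two
    summands, so that A A^-1 cancels as a whole.\<close>
  define A0 where "A0 = A"
  have dimA0 [simp]: "dim_row A0 = d" "dim_col A0 = d" by (simp_all add: A0_def)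
  have A0_Ai: "A0 * Ai = 1\<^sub>m d" by (simp add: A0_def inverse)
  have A0_Ai_mult: "A0 * (Ai * X) = X" if "dim_row X = d" for X
    using that mat_mult_assoc_dim[of A0 Ai X] by (simp add: A0_Ai mat_one_mult_dim)
  \<comment> \<open>The expanded product with \<open>?D\<close>, where E = I, W = U^T U A^-1 and Z =
    U^T J U A^-1.\<close>
  have cancel: "E + (1 / c) \<cdot>\<^sub>m W - (Z + (1 / c) \<cdot>\<^sub>m (W - c \<cdot>\<^sub>m Z)) = E"
    if "dim_row E = p" "dim_row Z = p" "dim_row W = p"
      "dim_col E = p" "dim_col Z = p" "dim_col W = p" for E Z W :: "real mat" and p
    using that c by (auto intro!: eq_matI simp: field_simps)
  have "(A0 + (1 / c) \<cdot>\<^sub>m (transpose_mat U * U)) * ?D = 1\<^sub>m d"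
    by (simp add: mat_ring_simps A0_Ai A0_Ai_mult UJ cancel[of _ d])
  then have minvD: "minv (A + (1 / c) \<cdot>\<^sub>m (transpose_mat U * U)) = ?D"
    unfolding A0_def by (intro minv_eqI[of _ d] carrier_matI) simp_all
  \<comment> \<open>By \<open>pinv_B\<close> this is B times its pseudoinverse, the orthogonal
    projection onto the range of B.\<close>
  define H where "H = B * (Ai * transpose_mat B)"
  have dimH [simp]: "dim_row H = m" "dim_col H = m" by (simp_all add: H_def)
  have S: "S = H" unfolding S_def H_def minvA by (simp add: mat_ring_simps)
  have S': "S' = H - transpose_mat V * (J * V)"
    unfolding S'_def minvD V H_def by (simp add: mat_ring_simps Ai_sym)
  have dimV [simp]: "dim_row V = r" "dim_col V = m" by (simp_all add: V)
  show "S' = S - transpose_mat V * minv K * V"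
    unfolding S S' minvK by (simp add: mat_ring_simps)

  have H: "H \<in> carrier_mat m m" "transpose_mat H = H" "H * H = H"
    by (rule carrier_matI) (simp_all add: H_def mat_ring_simps Ai_sym gram_Ai_B)
  have HV: "H * transpose_mat V = transpose_mat V"
    unfolding VT H_def by (simp add: mat_ring_simps B_Ai_gram_mult)
  have VV: "V * transpose_mat V = P"
    unfolding VT P unfolding V by (simp add: mat_ring_simps)
  have KP: "K = K' + P" unfolding K K' by (simp add: assoc(2)[of _ r _ _ r])
  \<comment> \<open>Substituting K = K' + P, where P = V V^T, turns these into the resolvent
    identities J P J' = J' - J = J' P J required by \<open>pinv_projection_update\<close> with W =
    V^T.\<close>
  have "J * (K * J') = J'" "J' * (K * J) = J'"
    using mat_mult_assoc_dim[of J K J'] JK J(2) by (simp_all add: mat_one_mult_dim)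
  then have JPJ: "J + J * (P * J') = J'" "J + J' * (P * J) = J'"
    using mat_mult_assoc_dim[of J' K' J] JK J'(2) unfolding KP
    by (simp_all add: mat_ring_simps)
  have VJ: "V * (transpose_mat V * X) = P * X" if "dim_row X = r" for X
    using mat_mult_assoc_dim[of V "transpose_mat V" X] that VV by simp
  have "pinv (H - transpose_mat V * (J * V)) = H + transpose_mat V * (J' * V)"
    using pinv_projection_update[OF H, of "transpose_mat V" r J J'] HV J(1) J'(1)
      mat_add_eq_imp_eq_minus[OF JPJ(1)] mat_add_eq_imp_eq_minus[OF JPJ(2)]
    by (simp add: VJ carrier_matI)
  then show "pinv S' = pinv S + transpose_mat V * minv K' * V"
    unfolding S S' minvK using pinv_projection[OF H] by (simp add: mat_ring_simps)
qed

end

section \<open>Kronecker products and horizontal concatenation\<close>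

lemma dim_kron [simp]:
  "dim_row (kron A B) = dim_row A * dim_row B" "dim_col (kron A B) = dim_col A * dim_col B"
  by (simp_all add: kron_def)

lemma index_kron:
  "i < dim_row A * dim_row B \<Longrightarrow> j < dim_col A * dim_col B \<Longrightarrow>
    kron A B $$ (i, j) =
      A $$ (i div dim_row B, j div dim_col B) * B $$ (i mod dim_row B, j mod dim_col B)"
  by (simp add: kron_def)

lemma div_mod_less:
  assumes "(i::nat) < a * b"
  shows "i div b < a" "i mod b < b"
proof -
  have "b > 0" using assms by (cases "b = 0") auto
  then show "i mod b < b" by simp
  show "i div b < a" using assms by (rule less_mult_imp_div_less)
qed

text \<open>Row and column indices of a Kronecker product code pairs (a, b) as a * q + b; decoding
  the summation index turns one sum into a double sum.\<close>

lemma sum_div_mod: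
  fixes f :: "nat \<Rightarrow> nat \<Rightarrow> real"
  shows "(\<Sum>t<p * q. f (t div q) (t mod q)) = (\<Sum>a<p. \<Sum>b<q. f a b)"
proof -
  have bound: "a * q + b < p * q" if "a < p" "b < q" for a b
  proof -
    have "a * q + b < Suc a * q" using that by simp
    also have "\<dots> \<le> p * q" using that by (intro mult_le_mono1) simp
    finally show ?thesis .
  qed
  have "(\<Sum>t<p * q. f (t div q) (t mod q)) = (\<Sum>(a, b)\<in>{..<p} \<times> {..<q}. f a b)"
    by (rule sum.reindex_bij_witness[of _ "\<lambda>(a, b). a * q + b" "\<lambda>t. (t div q, t mod q)"])
      (auto simp: bound div_mod_less)
  then show ?thesis by (simp add: sum.cartesian_product)
qed

lemma index_mult_mat_sum:
  fixes A B :: "real mat"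
  assumes "dim_col A = dim_row B" "i < dim_row A" "j < dim_col B"
  shows "(A * B) $$ (i, j) = (\<Sum>t<dim_row B. A $$ (i, t) * B $$ (t, j))"
  using assms by (simp add: scalar_prod_def atLeast0LessThan)

text \<open>The mixed-product rule. After the inner index is decoded into a pair, the summand
  separates and the double sum factors into two matrix entries.\<close>

lemma kron_mult_kron:
  assumes AC: "dim_col A = dim_row C" and BD: "dim_col B = dim_row D"
  shows "kron A B * kron C D = kron (A * C) (B * D)"
proof (rule eq_matI)
  fix i j assume "i < dim_row (kron (A * C) (B * D))" "j < dim_col (kron (A * C) (B * D))"
  then have i: "i < dim_row A * dim_row B" and j: "j < dim_col C * dim_col D" by simp_all
  let ?i = "i div dim_row B" and ?i' = "i mod dim_row B"
  let ?j = "j div dim_col D" and ?j' = "j mod dim_col D"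
  have "(kron A B * kron C D) $$ (i, j) =
      (\<Sum>t<dim_row C * dim_row D. kron A B $$ (i, t) * kron C D $$ (t, j))"
    using i j AC BD by (subst index_mult_mat_sum) simp_all
  also have "\<dots> = (\<Sum>t<dim_row C * dim_row D.
      (A $$ (?i, t div dim_row D) * B $$ (?i', t mod dim_row D)) *
      (C $$ (t div dim_row D, ?j) * D $$ (t mod dim_row D, ?j')))"
    using i j AC BD by (intro sum.cong) (simp_all add: index_kron)
  also have "\<dots> = (\<Sum>a<dim_row C. \<Sum>b<dim_row D.
      (A $$ (?i, a) * C $$ (a, ?j)) * (B $$ (?i', b) * D $$ (b, ?j')))"
    by (subst sum_div_mod) (simp add: mult_ac)
  also have "\<dots> = (A * C) $$ (?i, ?j) * (B * D) $$ (?i', ?j')"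
    using AC BD div_mod_less[OF i] div_mod_less[OF j]
    by (simp only: index_mult_mat_sum sum_product)
  also have "\<dots> = kron (A * C) (B * D) $$ (i, j)"
    using i j by (simp add: index_kron del: index_mult_mat(1))
  finally show "(kron A B * kron C D) $$ (i, j) = kron (A * C) (B * D) $$ (i, j)" .
qed simp_all

lemma transpose_kron: "transpose_mat (kron A B) = kron (transpose_mat A) (transpose_mat B)"
proof (rule eq_matI)
  fix i j assume "i < dim_row (kron (transpose_mat A) (transpose_mat B))"
    "j < dim_col (kron (transpose_mat A) (transpose_mat B))"
  then have i: "i < dim_col A * dim_col B" and j: "j < dim_row A * dim_row B" by simp_all
  then show "transpose_mat (kron A B) $$ (i, j) = kron (transpose_mat A) (transpose_mat B) $$ (i, j)"
    using div_mod_less[OF i] div_mod_less[OF j] by (simp add: index_kron)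
qed simp_all

lemma kron_one: "kron (1\<^sub>m a) (1\<^sub>m b) = 1\<^sub>m (a * b)"
proof (rule eq_matI)
  fix i j assume "i < dim_row (1\<^sub>m (a * b) :: real mat)" "j < dim_col (1\<^sub>m (a * b) :: real mat)"
  then have i: "i < a * b" and j: "j < a * b" by simp_all
  have "i div b = j div b \<and> i mod b = j mod b \<longleftrightarrow> i = j"
    by (metis div_mult_mod_eq)
  then show "kron (1\<^sub>m a) (1\<^sub>m b) $$ (i, j) = 1\<^sub>m (a * b) $$ (i, j)"
    using i j div_mod_less[OF i] div_mod_less[OF j] by (auto simp: index_kron)
qed simp_all

section \<open>Products of horizontally concatenated blocks\<close>

lemma dim_hcat [simp]: "dim_row (hcat A B) = dim_row A" "dim_col (hcat A B) = dim_col A + dim_col B"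
  by (simp_all add: hcat_def)

lemma hcat_mult_transpose_hcat:
  assumes "dim_row A = dim_row B" "dim_row C = dim_row D"
    "dim_col A = dim_col C" "dim_col B = dim_col D"
  shows "hcat A B * transpose_mat (hcat C D) = A * transpose_mat C + B * transpose_mat D"
proof (rule eq_matI)
  fix i j assume "i < dim_row (A * transpose_mat C + B * transpose_mat D)"
    "j < dim_col (A * transpose_mat C + B * transpose_mat D)"
  then have i: "i < dim_row A" and j: "j < dim_row C" using assms by simp_all
  let ?a = "dim_col A" and ?b = "dim_col B"
  have split: "sum f {..<a + b} = sum f {..<a} + (\<Sum>t<b. f (a + t))"
    for f :: "nat \<Rightarrow> real" and a b :: nat
    by (induction b) (simp_all add: sum.lessThan_Suc)
  have "(hcat A B * transpose_mat (hcat C D)) $$ (i, j) =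
      (\<Sum>t<?a + ?b. hcat A B $$ (i, t) * hcat C D $$ (j, t))"
    using i j assms by (subst index_mult_mat_sum) simp_all
  also have "\<dots> = (\<Sum>t<?a. hcat A B $$ (i, t) * hcat C D $$ (j, t)) +
      (\<Sum>t<?b. hcat A B $$ (i, ?a + t) * hcat C D $$ (j, ?a + t))"
    by (rule split)
  also have "\<dots> = (\<Sum>t<?a. A $$ (i, t) * C $$ (j, t)) + (\<Sum>t<?b. B $$ (i, t) * D $$ (j, t))"
    using i j assms by (intro arg_cong2[of _ _ _ _ "(+)"] sum.cong) (simp_all add: hcat_def)
  also have "\<dots> = (A * transpose_mat C + B * transpose_mat D) $$ (i, j)"
    using i j assms by (simp add: index_mult_mat_sum del: index_mult_mat(1))
  finally show "(hcat A B * transpose_mat (hcat C D)) $$ (i, j) =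
    (A * transpose_mat C + B * transpose_mat D) $$ (i, j)" .
qed (use assms in simp_all)

lemma transpose_hcat_mult_hcat:
  assumes "dim_row A = p" "dim_row B = p"
  shows "transpose_mat (hcat A B) * hcat A B =
    four_block_mat (transpose_mat A * A) (transpose_mat A * B)
      (transpose_mat B * A) (transpose_mat B * B)"
proof (rule eq_matI)
  have col: "col (hcat A B) i = (if i < dim_col A then col A i else col B (i - dim_col A))"
    if "i < dim_col A + dim_col B" for i
    using that assms by (intro eq_vecI) (auto simp: hcat_def)
  fix i j
  assume "i < dim_row (four_block_mat (transpose_mat A * A) (transpose_mat A * B)
      (transpose_mat B * A) (transpose_mat B * B))"
    "j < dim_col (four_block_mat (transpose_mat A * A) (transpose_mat A * B)
      (transpose_mat B * A) (transpose_mat B * B))"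
  then have "i < dim_col A + dim_col B" "j < dim_col A + dim_col B" by simp_all
  then show "(transpose_mat (hcat A B) * hcat A B) $$ (i, j) =
    four_block_mat (transpose_mat A * A) (transpose_mat A * B)
      (transpose_mat B * A) (transpose_mat B * B) $$ (i, j)"
    using assms by (auto simp: col)
qed simp_all

text \<open>The off-diagonal blocks of the two Gram matrices cancel in the sum, leaving a
  block-diagonal matrix that is inverted block by block. In each block one factor is injective, as L
  and L' witness, and the other adds a positive semidefinite term.\<close>

lemma hcat_gram_sum_inverse:
  assumes X: "X \<in> carrier_mat p a" and Y: "Y \<in> carrier_mat p b"
    and Z: "Z \<in> carrier_mat q a" and W: "W \<in> carrier_mat q b"
    and off_diagonal: "transpose_mat X * Y + transpose_mat Z * W = 0\<^sub>m a b"
    and L: "L \<in> carrier_mat a p" "L * X = 1\<^sub>m a"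
    and L': "L' \<in> carrier_mat b p" "L' * Y = 1\<^sub>m b"
  obtains R where "R \<in> carrier_mat (a + b) (a + b)"
    "(transpose_mat (hcat X Y) * hcat X Y + transpose_mat (hcat Z W) * hcat Z W) * R = 1\<^sub>m (a + b)"
proof -
  note dims [simp] = carrier_matD[OF X] carrier_matD[OF Y] carrier_matD[OF Z] carrier_matD[OF W]
  let ?M = "transpose_mat X * X + transpose_mat Z * Z"
  let ?N = "transpose_mat Y * Y + transpose_mat W * W"
  obtain R where R: "R \<in> carrier_mat a a" "?M * R = 1\<^sub>m a"
    using gram_plus_psd_inverse[OF X L psd_mat_gram[OF Z]] by blast
  obtain R' where R': "R' \<in> carrier_mat b b" "?N * R' = 1\<^sub>m b"
    using gram_plus_psd_inverse[OF Y L' psd_mat_gram[OF W]] by blast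
  have "transpose_mat (transpose_mat X * Y + transpose_mat Z * W) =
      transpose_mat Y * X + transpose_mat W * Z"
    by (simp add: mat_transpose_dim)
  then have off: "transpose_mat Y * X + transpose_mat W * Z = 0\<^sub>m b a"
    by (simp add: off_diagonal)
  have "transpose_mat (hcat X Y) * hcat X Y + transpose_mat (hcat Z W) * hcat Z W =
    four_block_mat ?M (transpose_mat X * Y + transpose_mat Z * W)
      (transpose_mat Y * X + transpose_mat W * Z) ?N"
    unfolding transpose_hcat_mult_hcat[OF dims(1,3)] transpose_hcat_mult_hcat[OF dims(5,7)]
    by (rule eq_matI) (auto simp del: index_mult_mat(1))
  then have blocks: "transpose_mat (hcat X Y) * hcat X Y + transpose_mat (hcat Z W) * hcat Z W =
    four_block_mat ?M (0\<^sub>m a b) (0\<^sub>m b a) ?N"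
    by (simp only: off off_diagonal)
  note dimR [simp] = carrier_matD[OF R(1)] carrier_matD[OF R'(1)]
  show thesis
  proof (rule that)
    show "four_block_mat R (0\<^sub>m a b) (0\<^sub>m b a) R' \<in> carrier_mat (a + b) (a + b)"
      by (rule carrier_matI) simp_all
    have c: "?M \<in> carrier_mat a a" "?N \<in> carrier_mat b b"
      by (rule carrier_matI; simp)+
    have "four_block_mat ?M (0\<^sub>m a b) (0\<^sub>m b a) ?N * four_block_mat R (0\<^sub>m a b) (0\<^sub>m b a) R' =
      four_block_mat (1\<^sub>m a) (0\<^sub>m a b) (0\<^sub>m b a) (1\<^sub>m b)"
      unfolding mult_four_block_mat[OF c(1) zero_carrier_mat zero_carrier_mat c(2)
          R(1) zero_carrier_mat zero_carrier_mat R'(1)] R(2) R'(2)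
      by (simp add: mat_zero_mult_dim mat_zero_add_dim)
    also have "\<dots> = 1\<^sub>m (a + b)" by (rule eq_matI) auto
    finally show "(transpose_mat (hcat X Y) * hcat X Y + transpose_mat (hcat Z W) * hcat Z W) *
      four_block_mat R (0\<^sub>m a b) (0\<^sub>m b a) R' = 1\<^sub>m (a + b)"
      unfolding blocks .
  qed
qed

section \<open>Selection matrices\<close>

text \<open>Distinctness makes the rows orthonormal and gives each index in \<open>set js\<close>
  exactly one position, so its diagonal entry in U^T U is 1.\<close>

lemma selection_mat:
  fixes js :: "nat list" and d :: nat
  assumes "distinct js" "set js \<subseteq> {..<d}"
  defines "U \<equiv> mat (length js) d (\<lambda>(k, j). if j = js ! k then 1 else (0 :: real))"
  shows "U * transpose_mat U = 1\<^sub>m (length js)"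
    and "transpose_mat U * U = mat d d (\<lambda>(i, j). if i = j \<and> i \<in> set js then 1 else 0)"
proof -
  have dims [simp]: "dim_row U = length js" "dim_col U = d" by (simp_all add: U_def)
  have U: "U $$ (k, j) = (if j = js ! k then 1 else 0)" if "k < length js" "j < d" for k j
    using that by (simp add: U_def)
  show "U * transpose_mat U = 1\<^sub>m (length js)"
  proof (rule eq_matI)
    fix k l assume "k < dim_row (1\<^sub>m (length js) :: real mat)" "l < dim_col (1\<^sub>m (length js) :: real mat)"
    then have kl: "k < length js" "l < length js" by simp_all
    then have "js ! k < d" using assms(2) nth_mem[of k js] by blast
    have "(U * transpose_mat U) $$ (k, l) = (\<Sum>j<d. U $$ (k, j) * U $$ (l, j))"
      using kl by (subst index_mult_mat_sum) simp_all
    also have "\<dots> = (\<Sum>j<d. if j = js ! k then (if js ! k = js ! l then 1 else 0) else 0)"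
      using kl by (intro sum.cong) (auto simp: U)
    also have "\<dots> = (if k = l then 1 else 0)"
      using kl \<open>js ! k < d\<close> assms(1) by (simp add: nth_eq_iff_index_eq)
    finally show "(U * transpose_mat U) $$ (k, l) = 1\<^sub>m (length js) $$ (k, l)" using kl by simp
  qed simp_all
  show "transpose_mat U * U = mat d d (\<lambda>(i, j). if i = j \<and> i \<in> set js then 1 else 0)" (is "_ = ?E")
  proof (rule eq_matI)
    fix i j assume "i < dim_row ?E" "j < dim_col ?E"
    then have ij: "i < d" "j < d" by simp_all
    have eq: "(transpose_mat U * U) $$ (i, j) = (\<Sum>k<length js. if i = js ! k \<and> j = i then 1 else 0)"
      using ij by (subst index_mult_mat_sum) (auto simp: U intro!: sum.cong)
    show "(transpose_mat U * U) $$ (i, j) = ?E $$ (i, j)"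
    proof (cases "i = j \<and> i \<in> set js")
      case True
      then obtain l where l: "l < length js" "js ! l = i" by (auto simp: in_set_conv_nth)
      have "(\<Sum>k<length js. if i = js ! k \<and> j = i then 1 else 0 :: real) =
          (\<Sum>k<length js. if k = l then 1 else 0)"
        using True l assms(1) by (intro sum.cong) (auto simp: nth_eq_iff_index_eq)
      then show ?thesis using eq True l ij by auto
    next
      case False
      then have "(\<Sum>k<length js. if i = js ! k \<and> j = i then 1 else 0 :: real) = 0"
        by (intro sum.neutral) auto
      then show ?thesis using eq False ij by auto
    qed
  qed simp_all
qed

text \<open>Diagonal with entries 0 or 1. Such a matrix is determined by the positions of its
  diagonal ones, and the property passes to Kronecker products and block sums, from which
  \<open>Isim\<close> is built.\<close>

definition diag01 :: "nat \<Rightarrow> real mat \<Rightarrow> bool" where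
  "diag01 d M \<longleftrightarrow> dim_row M = d \<and> dim_col M = d \<and>
    (\<forall>i<d. \<forall>j<d. M $$ (i, j) = 0 \<or> i = j \<and> M $$ (i, j) = 1)"

lemma diag01_kron:
  assumes "diag01 a A" "diag01 b B"
  shows "diag01 (a * b) (kron A B)"
  unfolding diag01_def
proof (intro conjI allI impI)
  show "dim_row (kron A B) = a * b" "dim_col (kron A B) = a * b"
    using assms by (simp_all add: diag01_def)
  fix i j assume i: "i < a * b" and j: "j < a * b"
  have "A $$ (i div b, j div b) = 0 \<or> i div b = j div b \<and> A $$ (i div b, j div b) = 1"
    using assms(1) div_mod_less[OF i] div_mod_less[OF j] unfolding diag01_def by blast
  moreover have "B $$ (i mod b, j mod b) = 0 \<or> i mod b = j mod b \<and> B $$ (i mod b, j mod b) = 1"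
    using assms(2) div_mod_less[OF i] div_mod_less[OF j] unfolding diag01_def by blast
  moreover have "i = j" if "i div b = j div b" "i mod b = j mod b"
    using that by (metis div_mult_mod_eq)
  moreover have "kron A B $$ (i, j) = A $$ (i div b, j div b) * B $$ (i mod b, j mod b)"
    using assms i j by (simp add: index_kron diag01_def)
  ultimately show "kron A B $$ (i, j) = 0 \<or> i = j \<and> kron A B $$ (i, j) = 1"
    by auto
qed

lemma diag01_four_block:
  assumes "diag01 a A" "diag01 b B"
  shows "diag01 (a + b) (four_block_mat A (0\<^sub>m a b) (0\<^sub>m b a) B)"
  unfolding diag01_def
proof (intro conjI allI impI)
  show "dim_row (four_block_mat A (0\<^sub>m a b) (0\<^sub>m b a) B) = a + b"
    "dim_col (four_block_mat A (0\<^sub>m a b) (0\<^sub>m b a) B) = a + b"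
    using assms by (simp_all add: diag01_def)
  fix i j assume ij: "i < a + b" "j < a + b"
  show "four_block_mat A (0\<^sub>m a b) (0\<^sub>m b a) B $$ (i, j) = 0 \<or>
      i = j \<and> four_block_mat A (0\<^sub>m a b) (0\<^sub>m b a) B $$ (i, j) = 1"
  proof (cases "i < a \<or> j < a")
    case True
    then show ?thesis using ij assms by (auto simp: diag01_def)
  next
    case False
    then have "i - a < b" "j - a < b" "i - a = j - a \<longleftrightarrow> i = j" using ij by linarith+
    moreover from this have "B $$ (i - a, j - a) = 0 \<or> i - a = j - a \<and> B $$ (i - a, j - a) = 1"
      using assms(2) unfolding diag01_def by blast
    ultimately show ?thesis using False ij assms by (simp add: diag01_def)
  qed
qed

section \<open>The staggered grid operators\<close>

text \<open>\<open>Bm\<close> takes scaled differences, so scaled prefix sums undo it: a column with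
  n at j and -n at j + 1 has a nonzero prefix sum only up to row j.\<close>

lemma Bm_left_inverse: "mat (n - 1) n (\<lambda>(j, k). if k \<le> j then 1 / real n else 0) * Bm n = 1\<^sub>m (n - 1)"
  (is "?L * _ = _")
proof (rule eq_matI)
  fix i j assume "i < dim_row (1\<^sub>m (n - 1) :: real mat)" "j < dim_col (1\<^sub>m (n - 1) :: real mat)"
  then have i: "i < n - 1" and j: "j < n - 1" by simp_all
  have "(?L * Bm n) $$ (i, j) = (\<Sum>k<n. ?L $$ (i, k) * Bm n $$ (k, j))"
    using i j by (subst index_mult_mat_sum) (simp_all add: Bm_def)
  also have "\<dots> = (\<Sum>k<n. (if k = j then (if j \<le> i then 1 else 0) else 0) -
      (if k = Suc j then (if Suc j \<le> i then 1 else 0) else 0))"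
    using i j by (intro sum.cong) (auto simp: Bm_def)
  \<comment> \<open>The bound j < n - 1 puts both j and \<open>Suc j\<close> below n, so each delta
    sum picks up its term.\<close>
  also have "\<dots> = (if j \<le> i then 1 else 0) - (if Suc j \<le> i then 1 else 0)"
    using i j by (auto simp: sum_subtractf)
  also have "\<dots> = 1\<^sub>m (n - 1) $$ (i, j)" using i j by auto
  finally show "(?L * Bm n) $$ (i, j) = 1\<^sub>m (n - 1) $$ (i, j)" .
qed (simp_all add: Bm_def)

lemma dim_Bm [simp]: "dim_row (Bm n) = n" "dim_col (Bm n) = n - 1"
  by (simp_all add: Bm_def)

text \<open>Discretely, the divergence of a rotated gradient vanishes: by the mixed-product rule
  both block products are \<open>kron (Bm n) (Bm n)\<close>, with opposite signs.\<close>

lemma BB_mult_transpose_CC: "BB n * transpose_mat (CC n) = 0\<^sub>m (n * n) ((n - 1) * (n - 1))"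
proof -
  have "Bux n * Bqy n = kron (Bm n) (Bm n)" "Bvy n * Bqx n = kron (Bm n) (Bm n)"
    by (simp_all add: Bux_def Bqy_def Bvy_def Bqx_def kron_mult_kron mat_one_mult_dim)
  then have "BB n * transpose_mat (CC n) = kron (Bm n) (Bm n) + - kron (Bm n) (Bm n)"
    unfolding BB_def CC_def
    by (subst hcat_mult_transpose_hcat)
      (simp_all add: Bux_def Bvy_def Bqx_def Bqy_def transpose_uminus mult.commute)
  also have "\<dots> = 0\<^sub>m (n * n) ((n - 1) * (n - 1))"
    by (rule eq_matI) simp_all
  finally show ?thesis .
qed

text \<open>The off-diagonal contributions of B^T B and C^T C are
  \<open>kron (Bm n) (transpose_mat (Bm n))\<close> with opposite signs. The Kronecker products of
  the prefix-sum matrix L with an identity supply the left inverses of the two blocks of B.\<close>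

lemma AN_right_inverse:
  obtains R where "R \<in> carrier_mat (2 * n * (n - 1)) (2 * n * (n - 1))"
    "AN n * R = 1\<^sub>m (2 * n * (n - 1))"
proof -
  define L where "L = mat (n - 1) n (\<lambda>(j, k). if k \<le> j then 1 / real n else 0)"
  have dimL [simp]: "dim_row L = n - 1" "dim_col L = n" by (simp_all add: L_def)
  have L: "L * Bm n = 1\<^sub>m (n - 1)" unfolding L_def by (rule Bm_left_inverse)
  let ?X = "- Bux n" and ?Y = "- Bvy n" and ?Z = "- transpose_mat (Bqy n)" and ?W = "transpose_mat (Bqx n)"
  have dims [simp]: "dim_row (Bux n) = n * n" "dim_col (Bux n) = n * (n - 1)"
    "dim_row (Bvy n) = n * n" "dim_col (Bvy n) = n * (n - 1)"
    "dim_row (Bqx n) = n * (n - 1)" "dim_col (Bqx n) = (n - 1) * (n - 1)"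
    "dim_row (Bqy n) = n * (n - 1)" "dim_col (Bqy n) = (n - 1) * (n - 1)"
    by (simp_all add: Bux_def Bvy_def Bqx_def Bqy_def mult.commute)
  have "transpose_mat (Bux n) * Bvy n = kron (Bm n) (transpose_mat (Bm n))"
    "Bqy n * transpose_mat (Bqx n) = kron (Bm n) (transpose_mat (Bm n))"
    by (simp_all add: Bux_def Bvy_def Bqx_def Bqy_def transpose_kron kron_mult_kron mat_one_mult_dim)
  then have off: "transpose_mat ?X * ?Y + transpose_mat ?Z * ?W = 0\<^sub>m (n * (n - 1)) (n * (n - 1))"
    by (auto simp: transpose_uminus mult.commute intro!: eq_matI)
  have "kron (1\<^sub>m n) L * Bux n = 1\<^sub>m (n * (n - 1))" "kron L (1\<^sub>m n) * Bvy n = 1\<^sub>m (n * (n - 1))"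
    by (simp_all add: Bux_def Bvy_def kron_mult_kron mat_one_mult_dim L kron_one mult.commute)
  then have inv: "- kron (1\<^sub>m n) L * ?X = 1\<^sub>m (n * (n - 1))" "- kron L (1\<^sub>m n) * ?Y = 1\<^sub>m (n * (n - 1))"
    by simp_all
  obtain R where "R \<in> carrier_mat (n * (n - 1) + n * (n - 1)) (n * (n - 1) + n * (n - 1))"
    "AN n * R = 1\<^sub>m (n * (n - 1) + n * (n - 1))"
    unfolding AN_def BB_def CC_def
    by (rule hcat_gram_sum_inverse[OF _ _ _ _ off _ inv(1) _ inv(2),
          of "n * n" "(n - 1) * (n - 1)"])
      (rule carrier_matI; simp add: mult.commute)+
  moreover have "n * (n - 1) + n * (n - 1) = 2 * n * (n - 1)" by simp
  ultimately show thesis using that by metis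
qed

text \<open>\<open>Uidx\<close> lists the diagonal ones of \<open>Isim\<close> without repetition;
  as \<open>Isim\<close> is diagonal with entries 0 or 1, U^T U reproduces it.\<close>

lemma Um_selection:
  "Um n * transpose_mat (Um n) = 1\<^sub>m (length (Uidx n))"
  "transpose_mat (Um n) * Um n = Isim n"
proof -
  let ?J = "{j. j < 2 * n * (n - 1) \<and> Isim n $$ (j, j) = 1}"
  have "finite ?J" by simp
  then have set: "set (Uidx n) = ?J" and "distinct (Uidx n)" by (simp_all add: Uidx_def)
  note sel = selection_mat[OF this(2), of "2 * n * (n - 1)", folded Um_def]
  show "Um n * transpose_mat (Um n) = 1\<^sub>m (length (Uidx n))" by (rule sel(1)) (auto simp: set)
  have 1: "diag01 p (1\<^sub>m p)" "diag01 p (Dm p)" for p by (auto simp: diag01_def Dm_def)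
  have "diag01 (n * (n - 1) + (n - 1) * n) (Isim n)"
    using diag01_four_block[OF diag01_kron[OF 1(2) 1(1)] diag01_kron[OF 1(1) 1(2)], of n "n - 1" "n - 1" n]
    unfolding Isim_def by (simp add: mult.commute)
  moreover have "n * (n - 1) + (n - 1) * n = 2 * n * (n - 1)" by simp
  ultimately have I: "diag01 (2 * n * (n - 1)) (Isim n)" by (simp only:)
  have "mat (2 * n * (n - 1)) (2 * n * (n - 1)) (\<lambda>(i, j). if i = j \<and> i \<in> set (Uidx n) then 1 else 0) = Isim n"
    using I unfolding set diag01_def by (intro eq_matI) auto
  moreover have "transpose_mat (Um n) * Um n = mat (2 * n * (n - 1)) (2 * n * (n - 1))
      (\<lambda>(i, j). if i = j \<and> i \<in> set (Uidx n) then 1 else 0)"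
    by (rule sel(2)) (auto simp: set)
  ultimately show "transpose_mat (Um n) * Um n = Isim n" by simp
qed

theorem theorem2:
  fixes n :: nat
  assumes "n \<ge> 2"
  shows "invertible_mat (K1 n) \<and> invertible_mat (K2 n) \<and>
    SD n = SN n - transpose_mat (Um n * pinv (BB n)) * minv (K1 n) * (Um n * pinv (BB n)) \<and>
    pinv (SD n) = pinv (SN n) + transpose_mat (Um n * pinv (BB n)) * minv (K2 n) * (Um n * pinv (BB n))"
proof -
  obtain R where R: "R \<in> carrier_mat (2 * n * (n - 1)) (2 * n * (n - 1))"
    "AN n * R = 1\<^sub>m (2 * n * (n - 1))"
    by (rule AN_right_inverse)
  have BB: "BB n \<in> carrier_mat (n * n) (2 * n * (n - 1))"
    by (rule carrier_matI) (simp_all add: BB_def Bux_def Bvy_def mult.commute)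
  have CC: "CC n \<in> carrier_mat ((n - 1) * (n - 1)) (2 * n * (n - 1))"
    by (rule carrier_matI) (simp_all add: CC_def Bqx_def Bqy_def mult.commute)
  interpret orthogonal_factors "n * n" "(n - 1) * (n - 1)" "2 * n * (n - 1)" "BB n" "CC n" R
    using BB CC R BB_mult_transpose_CC unfolding AN_def by unfold_locales
  have U: "Um n \<in> carrier_mat (length (Uidx n)) (2 * n * (n - 1))" by (simp add: Um_def)
  \<comment> \<open>Here c = h^2/2. The coefficient 2/h^2 in \<open>AD\<close> is 1/c, so writing
    \<open>Isim\<close> as U^T U puts \<open>AD\<close> in the form A + (1/c) U^T U.\<close>
  have c: "(1 / real n)\<^sup>2 / 2 > 0" "2 / (1 / real n)\<^sup>2 = 1 / ((1 / real n)\<^sup>2 / 2)"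
    using assms by simp_all
  show ?thesis
    using schur_complement_update[OF U Um_selection(1) c(1)]
    unfolding K1_def K2_def SD_def SN_def AD_def AN_def Um_selection(2)[symmetric] c(2)
    by blast
qed

end
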